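(* Let $\Delta>0$ and $p>0$. Suppose the times at which a web page changes form a time-homogeneous Poisson point process on $[0,\infty)$ with rate $\Delta$, and, independently, the page is accessed at times $0=t_0<t_1<t_2<\cdots$ where $\{t_k-t_{k-1}\}_{k\ge1}$ are i.i.d. exponential random variables with rate $p$. For $k\ge 1$ let $I_k=1$ if the page changed at least once in $(t_{k-1},t_k]$ and $I_k=0$ otherwise. Let $\{\eta_k\}_{k\ge0}$ be a sequence of positive reals, let $y_0\in\mathbb{R}$, and define \[ y_{k+1}=y_k+\eta_k\big[I_{k+1}(y_k+p)-y_k\big],\qquad k\ge 0. \] Then: 1. If $\sum_{k=0}^\infty\eta_k=\infty$ and $\sum_{k=0}^\infty\eta_k^2<\infty$, then $\lim_{k\to\infty}y_k=\Delta$ almost surely. 2. If $\eta_k=1/(k+1)^{\eta}$ for some constant $\eta\in(0,1)$, then $\mathbb{E}|y_k-\Delta|=O\left(k^{-\eta/2}\right)$.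
   Context: Here $\Delta$ is unknown (to be estimated) and $p$ is known; $y_k$ is called the SA estimator. *)

theory Defs
  imports "HOL-Probability.Probability" "HOL-Library.Landau_Symbols"
begin

definition access_time :: "(nat \<Rightarrow> 'a \<Rightarrow> real) \<Rightarrow> nat \<Rightarrow> 'a \<Rightarrow> real" where
  "access_time tau k \<omega> = (\<Sum>i<k. tau i \<omega>)"

text \<open>Change times of the Poisson process with i.i.d. exponential interarrival times S:
  the (n+1)-th change happens at S_0 + ... + S_n.\<close>
definition change_time :: "(nat \<Rightarrow> 'a \<Rightarrow> real) \<Rightarrow> nat \<Rightarrow> 'a \<Rightarrow> real" where
  "change_time S n \<omega> = (\<Sum>j\<le>n. S j \<omega>)"

definition changed_ind :: "(nat \<Rightarrow> 'a \<Rightarrow> real) \<Rightarrow> (nat \<Rightarrow> 'a \<Rightarrow> real) \<Rightarrow> nat \<Rightarrow> 'a \<Rightarrow> real" where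
  "changed_ind S tau k \<omega> =
     (if \<exists>n. access_time tau (k - 1) \<omega> < change_time S n \<omega> \<and> change_time S n \<omega> \<le> access_time tau k \<omega>
      then 1 else 0)"

primrec SA_est :: "(nat \<Rightarrow> real) \<Rightarrow> real \<Rightarrow> real \<Rightarrow> (nat \<Rightarrow> real) \<Rightarrow> nat \<Rightarrow> real" where
  "SA_est eta p y0 I 0 = y0"
| "SA_est eta p y0 I (Suc k) =
     SA_est eta p y0 I k + eta k * (I (Suc k) * (SA_est eta p y0 I k + p) - SA_est eta p y0 I k)"

end

theory Submission
  imports Defs
begin

text \<open>
  In the superposition of the two processes every event is an access with probability
  \<open>r = p / (\<Delta> + p)\<close>, and by memorylessness the future is then a fresh copy; this first-event
  decomposition gives that the indicators \<open>J\<^sub>k = 1 - I\<^bsub>k+1\<^esub>\<close> satisfy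
  \<open>E (\<Prod>k\<in>K. J\<^sub>k) = r ^ card K\<close>, i.e. they are i.i.d. Bernoulli. The error \<open>z\<^sub>k = y\<^sub>k - \<Delta>\<close> obeys
  \<open>z\<^bsub>k+1\<^esub> = (1 - \<eta>\<^sub>k J\<^sub>k) z\<^sub>k - (\<Delta> + p) \<eta>\<^sub>k (J\<^sub>k - r)\<close>. By Kolmogorov's inequality the series
  \<open>\<Sum> \<eta>\<^sub>k (J\<^sub>k - r)\<close> converges almost surely when \<open>\<Sum> \<eta>\<^sub>k\<^sup>2 < \<infinity>\<close>, so that \<open>\<Sum> \<eta>\<^sub>k J\<^sub>k = \<infinity>\<close> and the
  recursion is a contraction with summable perturbation. For the rate, the second moments satisfy
  \<open>E z\<^bsub>k+1\<^esub>\<^sup>2 \<le> (1 - 2 r \<eta>\<^sub>k + 2 r \<eta>\<^sub>k\<^sup>2) E z\<^sub>k\<^sup>2 + C \<eta>\<^sub>k\<^sup>2\<close>, which forces \<open>E z\<^sub>k\<^sup>2 = O(\<eta>\<^sub>k)\<close>.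
\<close>

subsection \<open>Bernoulli sequences and Kolmogorov's inequality\<close>

text \<open>After \<open>n\<close> steps the state depends only on \<open>j 0\<close>, ...,
  \<open>j (n - 1)\<close>. This generic form serves both the stopped partial sums in Kolmogorov's
  inequality and the estimator itself.\<close>

primrec adapted_path :: "(nat \<Rightarrow> 'b \<Rightarrow> real \<Rightarrow> 'b) \<Rightarrow> 'b \<Rightarrow> (nat \<Rightarrow> real) \<Rightarrow> nat \<Rightarrow> 'b" where
  "adapted_path f x j 0 = x"
| "adapted_path f x j (Suc n) = f n (adapted_path f x j n) (j n)"

text \<open>For 0/1-valued variables the product moments determine the joint law, so
  \<open>J_moments\<close> encodes "i.i.d. Bernoulli with mean \<open>r\<close>" in a form that the
  first-event decomposition delivers directly.\<close>

locale bernoulli_moments = prob_space +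
  fixes J :: "nat \<Rightarrow> 'a \<Rightarrow> real" and r :: real
  assumes J_measurable [measurable]: "\<And>k. J k \<in> borel_measurable M"
    and J_01: "\<And>k \<omega>. J k \<omega> = 0 \<or> J k \<omega> = 1"
    and J_moments: "\<And>K. finite K \<Longrightarrow> expectation (\<lambda>\<omega>. \<Prod>k\<in>K. J k \<omega>) = r ^ card K"
begin

lemma J_prod_01: "finite K \<Longrightarrow> (\<Prod>k\<in>K. J k \<omega>) = 0 \<or> (\<Prod>k\<in>K. J k \<omega>) = 1"
proof (induction K rule: finite_induct)
  case (insert x F)
  then show ?case using J_01[of x \<omega>] by auto
qed simp

lemma J_prod_measurable [measurable]: "(\<lambda>\<omega>. \<Prod>k\<in>K. J k \<omega>) \<in> borel_measurable M"
  by measurable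

lemma integrable_mult_J_prod:
  fixes g :: "'a \<Rightarrow> real"
  assumes "integrable M g" "finite K"
  shows "integrable M (\<lambda>\<omega>. g \<omega> * (\<Prod>k\<in>K. J k \<omega>))"
proof (rule Bochner_Integration.integrable_bound[OF assms(1)])
  have [measurable]: "g \<in> borel_measurable M" using assms(1) by auto
  show "(\<lambda>\<omega>. g \<omega> * (\<Prod>k\<in>K. J k \<omega>)) \<in> borel_measurable M" by measurable
  have "norm (g \<omega> * (\<Prod>k\<in>K. J k \<omega>)) \<le> norm (g \<omega>)" for \<omega>
    using J_prod_01[OF assms(2), of \<omega>] by auto
  then show "AE \<omega> in M. norm (g \<omega> * (\<Prod>k\<in>K. J k \<omega>)) \<le> norm (g \<omega>)" by simp
qed

text \<open>Any function of a 0/1 variable is affine in it. Hence one step of the path is linear in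
  \<open>J n\<close>, which is what product moments can handle.\<close>

lemma split_path_Suc:
  fixes g :: "'b \<Rightarrow> real"
  shows "g (adapted_path f x (\<lambda>k. J k \<omega>) (Suc n)) =
    g (f n (adapted_path f x (\<lambda>k. J k \<omega>) n) 1) * J n \<omega>
    + (g (f n (adapted_path f x (\<lambda>k. J k \<omega>) n) 0)
       - g (f n (adapted_path f x (\<lambda>k. J k \<omega>) n) 0) * J n \<omega>)"
  using J_01[of n \<omega>] by auto

text \<open>At each time the path takes only finitely many values, which makes every function of it integrable.\<close>
lemma integrable_path:
  fixes g :: "'b \<Rightarrow> real"
  shows "integrable M (\<lambda>\<omega>. g (adapted_path f x (\<lambda>k. J k \<omega>) n))"
proof (induction n arbitrary: g)
  case (Suc n)
  have J: "integrable M (\<lambda>\<omega>. h (adapted_path f x (\<lambda>k. J k \<omega>) n) * J n \<omega>)" for h :: "'b \<Rightarrow> real"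
    using integrable_mult_J_prod[OF Suc.IH, of "{n}" h] by simp
  show ?case
    unfolding split_path_Suc
    by (intro Bochner_Integration.integrable_add Bochner_Integration.integrable_diff
          J[of "\<lambda>u. g (f n u 1)"] J[of "\<lambda>u. g (f n u 0)"] Suc.IH[of "\<lambda>u. g (f n u 0)"])
qed simp

text \<open>The past is uncorrelated with products of future indicators. Splitting the last step
  moves \<open>J n\<close> into the product, so the induction on \<open>n\<close> has to let both
  \<open>g\<close> and \<open>K\<close> vary.\<close>

lemma expectation_path_mult_J_prod:
  fixes g :: "'b \<Rightarrow> real"
  assumes "finite K" "K \<subseteq> {n..}"
  shows "expectation (\<lambda>\<omega>. g (adapted_path f x (\<lambda>k. J k \<omega>) n) * (\<Prod>k\<in>K. J k \<omega>)) =
    r ^ card K * expectation (\<lambda>\<omega>. g (adapted_path f x (\<lambda>k. J k \<omega>) n))"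
  using assms
proof (induction n arbitrary: g K)
  case 0
  then show ?case using J_moments prob_space by simp
next
  case (Suc n)
  let ?x = "\<lambda>\<omega>. adapted_path f x (\<lambda>k. J k \<omega>) n"
  have step: "expectation (\<lambda>\<omega>. g (adapted_path f x (\<lambda>k. J k \<omega>) (Suc n)) * (\<Prod>k\<in>L. J k \<omega>)) =
    r ^ card L * (r * expectation (\<lambda>\<omega>. g (f n (?x \<omega>) 1)) + (1 - r) * expectation (\<lambda>\<omega>. g (f n (?x \<omega>) 0)))"
    if L: "finite L" "L \<subseteq> {Suc n..}" for L
  proof -
    have nL: "n \<notin> L" using L by auto
    have E: "g (adapted_path f x (\<lambda>k. J k \<omega>) (Suc n)) * (\<Prod>k\<in>L. J k \<omega>) =
       g (f n (?x \<omega>) 1) * (\<Prod>k\<in>insert n L. J k \<omega>) +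
       (g (f n (?x \<omega>) 0) * (\<Prod>k\<in>L. J k \<omega>) - g (f n (?x \<omega>) 0) * (\<Prod>k\<in>insert n L. J k \<omega>))" for \<omega>
      unfolding split_path_Suc using nL L by (simp add: algebra_simps)
    note int = integrable_mult_J_prod[OF integrable_path]
    note I = int[of _ "\<lambda>u. g (f n u 1)"] int[of _ "\<lambda>u. g (f n u 0)"]
    note IH = Suc.IH[of _ "\<lambda>u. g (f n u 1)"] Suc.IH[of _ "\<lambda>u. g (f n u 0)"]
    have L': "finite (insert n L)" "insert n L \<subseteq> {n..}" "L \<subseteq> {n..}" using L by auto
    show ?thesis
      unfolding E
      apply (subst Bochner_Integration.integral_add[OF I(1)[OF L'(1)]
            Bochner_Integration.integrable_diff[OF I(2)[OF L(1)] I(2)[OF L'(1)]]])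
      apply (subst Bochner_Integration.integral_diff[OF I(2)[OF L(1)] I(2)[OF L'(1)]])
      unfolding IH(1)[OF L'(1,2)] IH(2)[OF L'(1,2)] IH(2)[OF L(1) L'(3)]
      using nL L by (simp add: algebra_simps)
  qed
  \<comment> \<open>The instance \<open>{}\<close> identifies the bracket in \<open>step\<close>
    with the expectation of \<open>g\<close> at time \<open>Suc n\<close>.\<close>
  show ?case
    using step[OF Suc.prems] step[of "{}"] by simp
qed

text \<open>One-step conditioning: \<open>J n\<close> is averaged out with weights \<open>r\<close>
  and \<open>1 - r\<close> because it is uncorrelated with every function of the state at time
  \<open>n\<close>.\<close>

lemma expectation_path_Suc:
  fixes g :: "'b \<Rightarrow> real"
  shows "expectation (\<lambda>\<omega>. g (adapted_path f x (\<lambda>k. J k \<omega>) (Suc n))) =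
    expectation (\<lambda>\<omega>. r * g (f n (adapted_path f x (\<lambda>k. J k \<omega>) n) 1)
      + (1 - r) * g (f n (adapted_path f x (\<lambda>k. J k \<omega>) n) 0))"
proof -
  let ?x = "\<lambda>\<omega>. adapted_path f x (\<lambda>k. J k \<omega>) n"
  note I1 = integrable_path[of "\<lambda>u. g (f n u 1)" f x n]
  note I0 = integrable_path[of "\<lambda>u. g (f n u 0)" f x n]
  have J: "integrable M (\<lambda>\<omega>. h (?x \<omega>) * J n \<omega>)"
     "expectation (\<lambda>\<omega>. h (?x \<omega>) * J n \<omega>) = r * expectation (\<lambda>\<omega>. h (?x \<omega>))" for h :: "'b \<Rightarrow> real"
    using integrable_mult_J_prod[OF integrable_path, of "{n}" h f x n]
      expectation_path_mult_J_prod[of "{n}" n h f x] by simp_all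
  note J1 = J[of "\<lambda>u. g (f n u 1)"] and J0 = J[of "\<lambda>u. g (f n u 0)"]
  show ?thesis
    unfolding split_path_Suc using I1 I0 J1 J0
    by (simp add: algebra_simps)
qed

lemma r_bounds: "0 \<le> r" "r \<le> 1"
proof -
  have r: "expectation (J 0) = r" using J_moments[of "{0}"] by simp
  have i: "integrable M (J 0)"
    using integrable_mult_J_prod[of "\<lambda>_. 1" "{0}"] by simp
  show "0 \<le> r" unfolding r[symmetric]
    by (rule Bochner_Integration.integral_nonneg_AE) (use J_01[of 0] in \<open>auto intro!: AE_I2; metis zero_le_one order_refl\<close>)
  show "r \<le> 1" unfolding r[symmetric]
    by (rule integral_le_const[OF i]) (use J_01[of 0] in \<open>auto intro!: AE_I2; metis zero_le_one order_refl\<close>)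
qed

text \<open>Kolmogorov's inequality. If some partial sum leaves the interval, the stopped sum is
  still outside at time \<open>n\<close>; its second moment is at most the sum of the
  \<open>(c i)\<^sup>2\<close>, and Markov's inequality for its square finishes.\<close>

lemma maximal_inequality:
  fixes c :: "nat \<Rightarrow> real"
  assumes "m \<le> n" "0 < \<epsilon>"
  shows "prob {\<omega> \<in> space M. \<exists>k\<in>{m..n}. \<epsilon> \<le> \<bar>\<Sum>i=m..<k. c i * (J i \<omega> - r)\<bar>}
    \<le> (\<Sum>i=m..<n. (c i)\<^sup>2) / \<epsilon>\<^sup>2"
proof -
  \<comment> \<open>the partial sums, frozen as soon as they leave the interval of radius \<open>\<epsilon>\<close>\<close>
  define f where "f k u j = (if k < m \<or> \<epsilon> \<le> \<bar>u\<bar> then u else u + c k * (j - r))" for k and u j :: real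
  let ?T = "\<lambda>k \<omega>. adapted_path f 0 (\<lambda>k. J k \<omega>) k"
  let ?S = "\<lambda>k \<omega>. \<Sum>i=m..<k. c i * (J i \<omega> - r)"
  have zero: "?T k \<omega> = 0" if "k \<le> m" for k \<omega>
    using that by (induction k) (auto simp: f_def)
  have stopped: "\<epsilon> \<le> \<bar>?T k \<omega>\<bar> \<or> ?T k \<omega> = ?S k \<omega> \<and> (\<forall>l\<in>{m..k}. \<bar>?S l \<omega>\<bar> < \<epsilon>)"
    if "m \<le> k" for k \<omega>
    using that
  proof (induction k rule: dec_induct)
    case base
    then show ?case using zero[of m] assms(2) by auto
  next
    case (step k)
    have "?S (Suc k) \<omega> = ?S k \<omega> + c k * (J k \<omega> - r)" using step.hyps by simp
    then show ?case using step by (auto simp: f_def le_Suc_eq)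
  qed
  have moment: "expectation (\<lambda>\<omega>. (?T k \<omega>)\<^sup>2) \<le> (\<Sum>i=m..<k. (c i)\<^sup>2)" for k
  proof (induction k)
    case (Suc k)
    show ?case
    proof (cases "k < m")
      case True
      then show ?thesis using zero[of "Suc k"] by simp
    next
      case False
      have "r * (f k u 1)\<^sup>2 + (1 - r) * (f k u 0)\<^sup>2 \<le> u\<^sup>2 + (c k)\<^sup>2" for u
      proof (cases "\<epsilon> \<le> \<bar>u\<bar>")
        case True
        then show ?thesis by (simp add: f_def algebra_simps)
      next
        case f: False
        \<comment> \<open>The increment is centred, so the cross term drops out and only the
          variance \<open>r * (1 - r) \<le> 1\<close> of \<open>J k\<close> remains.\<close>
        have "r * (1 - r) \<le> 1 * 1" using r_bounds by (intro mult_mono) auto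
        then have "(r * (1 - r)) * (c k)\<^sup>2 \<le> 1 * (c k)\<^sup>2" by (intro mult_right_mono) auto
        moreover have "r * (f k u 1)\<^sup>2 + (1 - r) * (f k u 0)\<^sup>2 = u\<^sup>2 + (r * (1 - r)) * (c k)\<^sup>2"
          using f False by (simp add: f_def power2_eq_square algebra_simps)
        ultimately show ?thesis by simp
      qed
      then have "expectation (\<lambda>\<omega>. (?T (Suc k) \<omega>)\<^sup>2) \<le> expectation (\<lambda>\<omega>. (?T k \<omega>)\<^sup>2 + (c k)\<^sup>2)"
        unfolding expectation_path_Suc[of "\<lambda>u. u\<^sup>2"]
        by (intro integral_mono integrable_path[of "\<lambda>u. r * (f k u 1)\<^sup>2 + (1 - r) * (f k u 0)\<^sup>2"]
            integrable_path[of "\<lambda>u. u\<^sup>2 + (c k)\<^sup>2"]) auto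
      also have "\<dots> = expectation (\<lambda>\<omega>. (?T k \<omega>)\<^sup>2) + (c k)\<^sup>2"
        using integrable_path[of "\<lambda>u. u\<^sup>2" f 0 k] prob_space by simp
      finally show ?thesis using Suc.IH False by simp
    qed
  qed simp
  have T_meas [measurable]: "?T n \<in> borel_measurable M"
    using integrable_path[of "\<lambda>u. u" f 0 n] by auto
  have "prob {\<omega> \<in> space M. \<exists>k\<in>{m..n}. \<epsilon> \<le> \<bar>?S k \<omega>\<bar>} \<le> prob {\<omega> \<in> space M. \<epsilon>\<^sup>2 \<le> (?T n \<omega>)\<^sup>2}"
  proof (rule finite_measure_mono)
    show "{\<omega> \<in> space M. \<exists>k\<in>{m..n}. \<epsilon> \<le> \<bar>?S k \<omega>\<bar>} \<subseteq> {\<omega> \<in> space M. \<epsilon>\<^sup>2 \<le> (?T n \<omega>)\<^sup>2}"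
    proof safe
      fix \<omega> k assume "k \<in> {m..n}" "\<epsilon> \<le> \<bar>?S k \<omega>\<bar>"
      then have "\<epsilon> \<le> \<bar>?T n \<omega>\<bar>" using stopped[OF assms(1), of \<omega>] by force
      then show "\<epsilon>\<^sup>2 \<le> (?T n \<omega>)\<^sup>2" using assms(2) by (simp add: abs_le_square_iff[symmetric])
    qed
  qed measurable
  also have "\<dots> \<le> expectation (\<lambda>\<omega>. (?T n \<omega>)\<^sup>2) / \<epsilon>\<^sup>2"
    using integral_Markov_inequality_measure[of M "\<lambda>\<omega>. (?T n \<omega>)\<^sup>2" "{}" "\<epsilon>\<^sup>2"]
      integrable_path[of "\<lambda>u. u\<^sup>2" f 0 n] assms(2) by simp
  also have "\<dots> \<le> (\<Sum>i=m..<n. (c i)\<^sup>2) / \<epsilon>\<^sup>2"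
    using moment[of n] assms(2) by (simp add: divide_right_mono)
  finally show ?thesis .
qed

text \<open>Letting \<open>n\<close> grow in the maximal inequality, the probability that the sums
  started at \<open>m\<close> ever reach \<open>\<epsilon>\<close> is at most a tail of a convergent
  series. So almost surely some \<open>m\<close> works for each \<open>\<epsilon>\<close>, and
  countably many \<open>\<epsilon>\<close> give the Cauchy criterion.\<close>

lemma AE_summable_centered:
  fixes c :: "nat \<Rightarrow> real"
  assumes "summable (\<lambda>k. (c k)\<^sup>2)"
  shows "AE \<omega> in M. summable (\<lambda>k. c k * (J k \<omega> - r))"
proof -
  let ?S = "\<lambda>m k \<omega>. \<Sum>i=m..<k. c i * (J i \<omega> - r)"
  have "AE \<omega> in M. \<exists>m. \<forall>k\<ge>m. \<bar>?S m k \<omega>\<bar> < \<epsilon>" if \<epsilon>: "0 < \<epsilon>" for \<epsilon>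
  proof -
    let ?B = "\<lambda>m. {\<omega> \<in> space M. \<exists>k\<ge>m. \<epsilon> \<le> \<bar>?S m k \<omega>\<bar>}"
    let ?tail = "\<lambda>m. (\<Sum>i. (c (i + m))\<^sup>2) / \<epsilon>\<^sup>2"
    have bound: "prob (?B m) \<le> ?tail m" for m
    proof (rule LIMSEQ_le_const2)
      let ?A = "\<lambda>n. {\<omega> \<in> space M. \<exists>k\<in>{m..m+n}. \<epsilon> \<le> \<bar>?S m k \<omega>\<bar>}"
      have "(\<lambda>n. prob (?A n)) \<longlonglongrightarrow> prob (\<Union>n. ?A n)"
      proof (rule finite_Lim_measure_incseq)
        show "range ?A \<subseteq> events" by auto
        show "incseq ?A" by (force simp: incseq_def)
      qed
      also have "(\<Union>n. ?A n) = ?B m" by (force simp: le_iff_add)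
      finally show "(\<lambda>n. prob (?A n)) \<longlonglongrightarrow> prob (?B m)" .
      have "prob (?A n) \<le> ?tail m" for n
      proof -
        have "prob (?A n) \<le> (\<Sum>i=m..<m+n. (c i)\<^sup>2) / \<epsilon>\<^sup>2"
          using maximal_inequality[of m "m + n" \<epsilon> c] \<epsilon> by simp
        also have "(\<Sum>i=m..<m+n. (c i)\<^sup>2) = (\<Sum>i<n. (c (i + m))\<^sup>2)"
          using sum.shift_bounds_nat_ivl[of "\<lambda>i. (c i)\<^sup>2" 0 m n] by (simp add: lessThan_atLeast0 add.commute)
        also have "\<dots> \<le> (\<Sum>i. (c (i + m))\<^sup>2)"
          using assms by (intro sum_le_suminf) (auto simp: summable_iff_shift[of "\<lambda>k. (c k)\<^sup>2"])
        finally show ?thesis using \<epsilon> by (simp add: divide_right_mono)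
      qed
      then show "\<exists>N. \<forall>n\<ge>N. prob (?A n) \<le> ?tail m" by blast
    qed
    have tail: "?tail \<longlonglongrightarrow> 0"
      using tendsto_divide[OF suminf_exist_split2[OF assms] tendsto_const[of "\<epsilon>\<^sup>2"]] \<epsilon> by simp
    have "prob (\<Inter>m. ?B m) \<le> 0"
    proof (rule LIMSEQ_le_const[OF tail])
      have "prob (\<Inter>m. ?B m) \<le> prob (?B m)" for m
        by (rule finite_measure_mono) auto
      then show "\<exists>N. \<forall>m\<ge>N. prob (\<Inter>m. ?B m) \<le> ?tail m" using bound order_trans by blast
    qed
    then have "prob (\<Inter>m. ?B m) = 0" by (simp add: measure_le_0_iff)
    then have "AE \<omega> in M. \<omega> \<notin> (\<Inter>m. ?B m)"
      by (intro AE_not_in) (simp add: null_sets_def emeasure_eq_measure)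
    then show ?thesis
      by (rule AE_mp) (intro AE_I2 impI, force simp: not_le)
  qed
  then have "AE \<omega> in M. \<forall>q. \<exists>m. \<forall>k\<ge>m. \<bar>?S m k \<omega>\<bar> < 1 / real (Suc q)"
    by (subst AE_all_countable) simp
  then show ?thesis
  proof (rule AE_mp, intro AE_I2 impI)
    fix \<omega> assume small: "\<forall>q. \<exists>m. \<forall>k\<ge>m. \<bar>?S m k \<omega>\<bar> < 1 / real (Suc q)"
    show "summable (\<lambda>k. c k * (J k \<omega> - r))"
      unfolding summable_Cauchy
    proof (intro allI impI)
      fix e :: real assume "0 < e"
      \<comment> \<open>A block from \<open>a\<close> to \<open>b\<close> is the difference of two
        blocks started at \<open>m\<close>, hence the half.\<close>
      then obtain q where q: "1 / real (Suc q) < e / 2"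
        using nat_approx_posE[of "e/2"] by auto
      obtain m where m: "\<forall>k\<ge>m. \<bar>?S m k \<omega>\<bar> < 1 / real (Suc q)" using small by blast
      have "norm (?S a b \<omega>) < e" if "m \<le> a" for a b
      proof (cases "a \<le> b")
        case True
        have "?S m a \<omega> + ?S a b \<omega> = ?S m b \<omega>" using that True by (rule sum.atLeastLessThan_concat)
        moreover have "\<bar>?S m a \<omega>\<bar> < e/2" "\<bar>?S m b \<omega>\<bar> < e/2"
          using m that True q by (meson order_trans less_trans)+
        ultimately show ?thesis by auto
      qed (use \<open>0 < e\<close> in auto)
      then show "\<exists>N. \<forall>m\<ge>N. \<forall>n. norm (?S m n \<omega>) < e" by blast
    qed
  qed
qed

end

section \<open>Deterministic contractions with a summable perturbation\<close>

lemma perturbed_contraction_tendsto_0: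
  fixes a b z :: "nat \<Rightarrow> real"
  assumes rec: "\<And>k. z (Suc k) = (1 - a k) * z k + b k"
    and a: "eventually (\<lambda>k. 0 \<le> a k \<and> a k \<le> 1) sequentially"
    and a_div: "filterlim (\<lambda>n. \<Sum>k<n. a k) at_top sequentially"
    and b: "summable b"
  shows "z \<longlonglongrightarrow> 0"
proof -
  \<comment> \<open>absorb the perturbation into \<open>z\<close> by adding the tail of its series\<close>
  define t where "t k = (\<Sum>i. b (i + k))" for k
  define w where "w k = z k + t k" for k
  have t0: "t \<longlonglongrightarrow> 0" unfolding t_def by (rule suminf_exist_split2[OF b])
  have t_Suc: "t k = b k + t (Suc k)" for k
    using suminf_split_head[of "\<lambda>i. b (i + k)"] b by (simp add: t_def summable_iff_shift)
  \<comment> \<open>The perturbation now carries the weight \<open>a k\<close>: once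
    \<open>0 \<le> a k \<le> 1\<close>, the new value is a convex combination of \<open>w k\<close>
    and the small \<open>t k\<close>.\<close>
  have w_Suc: "w (Suc k) = (1 - a k) * w k + a k * t k" for k
    unfolding w_def rec using t_Suc[of k] by (simp add: algebra_simps)
  have "w \<longlonglongrightarrow> 0"
  proof (rule LIMSEQ_I)
    fix e :: real assume e: "0 < e"
    obtain N where N: "\<And>k. N \<le> k \<Longrightarrow> 0 \<le> a k \<and> a k \<le> 1" "\<And>k. N \<le> k \<Longrightarrow> \<bar>t k\<bar> < e / 2"
    proof -
      have "eventually (\<lambda>k. \<bar>t k\<bar> < e / 2) sequentially"
        using tendstoD[OF t0, of "e/2"] e by simp
      from eventually_conj[OF a this] show ?thesis using that by (auto simp: eventually_sequentially)
    qed
    let ?C = "\<bar>w N\<bar>"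
    \<comment> \<open>The excess over \<open>e / 2\<close> is damped by
      \<open>1 - a i \<le> exp (- a i)\<close> at every step.\<close>
    have bound: "\<bar>w k\<bar> \<le> e / 2 + ?C * exp (- (\<Sum>i=N..<k. a i))" if "N \<le> k" for k
      using that
    proof (induction k rule: dec_induct)
      case base
      then show ?case using e by simp
    next
      case (step k)
      have "\<bar>w (Suc k)\<bar> \<le> (1 - a k) * \<bar>w k\<bar> + a k * (e / 2)"
        unfolding w_Suc using N(1)[OF step.hyps(1)] less_imp_le[OF N(2)[OF step.hyps(1)]]
        by (intro order_trans[OF abs_triangle_ineq] add_mono) (simp_all add: abs_mult mult_left_mono del: times_divide_eq_right)
      also have "\<dots> \<le> (1 - a k) * (e / 2 + ?C * exp (- (\<Sum>i=N..<k. a i))) + a k * (e / 2)"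
        using N(1)[OF step.hyps(1)] step.IH by (intro add_mono mult_left_mono) auto
      also have "\<dots> = e / 2 + ?C * ((1 - a k) * exp (- (\<Sum>i=N..<k. a i)))"
        by (simp add: field_simps)
      also have "\<dots> \<le> e / 2 + ?C * (exp (- a k) * exp (- (\<Sum>i=N..<k. a i)))"
        using exp_ge_add_one_self[of "- a k"] by (intro add_mono mult_left_mono mult_right_mono) auto
      also have "\<dots> = e / 2 + ?C * exp (- (\<Sum>i=N..<Suc k. a i))"
        using step.hyps by (simp add: exp_add[symmetric] algebra_simps)
      finally show ?case .
    qed
    \<comment> \<open>Dropping the first \<open>N\<close> terms changes the divergent sum only by a
      constant.\<close>
    have "filterlim (\<lambda>n. - (\<Sum>k<N. a k) + (\<Sum>k<n. a k)) at_top sequentially"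
      by (rule filterlim_tendsto_add_at_top[OF tendsto_const a_div])
    also have "?this \<longleftrightarrow> filterlim (\<lambda>n. \<Sum>i=N..<n. a i) at_top sequentially"
    proof (intro filterlim_cong refl, unfold eventually_sequentially, intro exI[of _ N] allI impI)
      fix n assume "N \<le> n"
      then show "- (\<Sum>k<N. a k) + (\<Sum>k<n. a k) = (\<Sum>i=N..<n. a i)"
        using sum.atLeastLessThan_concat[of 0 N n a] by (simp add: lessThan_atLeast0)
    qed
    finally have "filterlim (\<lambda>n. \<Sum>i=N..<n. a i) at_top sequentially" .
    then have "((\<lambda>n. exp (- (\<Sum>i=N..<n. a i))) \<longlongrightarrow> 0) sequentially"
      by (intro filterlim_compose[OF exp_at_bot] filterlim_compose[OF filterlim_uminus_at_bot_at_top])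
    then have "(\<lambda>n. ?C * exp (- (\<Sum>i=N..<n. a i))) \<longlonglongrightarrow> ?C * 0" by (rule tendsto_mult_left)
    then have "eventually (\<lambda>n. ?C * exp (- (\<Sum>i=N..<n. a i)) < e / 2) sequentially"
      using e by (intro order_tendstoD(2)) auto
    then obtain N' where N': "\<And>n. N' \<le> n \<Longrightarrow> ?C * exp (- (\<Sum>i=N..<n. a i)) < e / 2"
      by (auto simp: eventually_sequentially)
    have "norm (w n - 0) < e" if "max N N' \<le> n" for n
      using bound[of n] N'[of n] that by auto
    then show "\<exists>no. \<forall>n\<ge>no. norm (w n - 0) < e" by blast
  qed
  then have "(\<lambda>k. w k - t k) \<longlonglongrightarrow> 0 - 0" using t0 by (rule tendsto_diff)
  then show ?thesis by (simp add: w_def)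
qed

subsection \<open>Competing exponential clocks\<close>

definition exp_measure :: "real \<Rightarrow> real measure" where
  "exp_measure l = density lborel (exponential_density l)"

lemma sets_exp_measure [simp, measurable_cong]: "sets (exp_measure l) = sets borel"
  by (simp add: exp_measure_def)

lemma space_exp_measure [simp]: "space (exp_measure l) = UNIV"
  by (simp add: exp_measure_def)

lemma prob_space_exp_measure: "0 < l \<Longrightarrow> prob_space (exp_measure l)"
  unfolding exp_measure_def by (rule prob_space_exponential_density)

lemma nn_integral_exp_measure:
  assumes [measurable]: "f \<in> borel_measurable borel"
  shows "(\<integral>\<^sup>+x. f x \<partial>exp_measure l) = (\<integral>\<^sup>+x. ennreal (exponential_density l x) * f x \<partial>lborel)"
  unfolding exp_measure_def by (subst nn_integral_density) auto

lemma AE_exp_measure_pos: "AE x in exp_measure l. 0 < x"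
proof -
  have "AE x in lborel. x \<noteq> (0::real)" by (rule AE_lborel_singleton)
  then have "AE x in lborel. 0 < ennreal (exponential_density l x) \<longrightarrow> 0 < x"
    by (rule AE_mp) (auto simp: exponential_density_def intro!: AE_I2)
  then show ?thesis unfolding exp_measure_def by (subst AE_density) auto
qed

lemma AE_exp_measure_neq: "AE x in exp_measure l. x \<noteq> c"
  using AE_lborel_singleton[of c] unfolding exp_measure_def by (subst AE_density) auto

text \<open>For fixed \<open>y\<close> the event \<open>y \<le> x\<close> has probability
  \<open>exp (- y * a)\<close>, and on it the residual \<open>x - y\<close> is again exponential
  with rate \<open>a\<close>, whatever \<open>y\<close> is. Averaging the survival probability over
  \<open>y\<close> gives \<open>b / (a + b)\<close>.\<close>

lemma nn_integral_exp_memoryless: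
  assumes a: "0 < a" and b: "0 < b" and [measurable]: "h \<in> borel_measurable borel"
  shows "(\<integral>\<^sup>+y. \<integral>\<^sup>+x. (if y \<le> x then h (x - y) else 0) \<partial>exp_measure a \<partial>exp_measure b) =
    ennreal (b / (a + b)) * (\<integral>\<^sup>+u. h u \<partial>exp_measure a)"
proof -
  have inner: "(\<integral>\<^sup>+x. (if y \<le> x then h (x - y) else 0) \<partial>exp_measure a) =
      ennreal (exp (- y * a)) * (\<integral>\<^sup>+u. h u \<partial>exp_measure a)" if y: "0 \<le> y" for y
  proof -
    have "(\<integral>\<^sup>+x. (if y \<le> x then h (x - y) else 0) \<partial>exp_measure a) =
        (\<integral>\<^sup>+x. ennreal (exponential_density a x) * (if y \<le> x then h (x - y) else 0) \<partial>lborel)"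
      by (rule nn_integral_exp_measure) measurable
    also have "\<dots> = (\<integral>\<^sup>+u. ennreal (exponential_density a (y + u)) * (if y \<le> y + u then h u else 0) \<partial>lborel)"
      by (subst nn_integral_real_affine[where c=1 and t=y]) (auto intro!: nn_integral_cong)
    also have "\<dots> = (\<integral>\<^sup>+u. ennreal (exp (- y * a)) * (ennreal (exponential_density a u) * h u) \<partial>lborel)"
    proof (rule nn_integral_cong)
      fix u :: real
      show "ennreal (exponential_density a (y + u)) * (if y \<le> y + u then h u else 0) =
        ennreal (exp (- y * a)) * (ennreal (exponential_density a u) * h u)"
      proof (cases "0 \<le> u")
        case True
        have "exponential_density a (y + u) = exp (- y * a) * exponential_density a u"
          using True y by (simp add: exponential_density_def exp_add[symmetric] left_diff_distrib)
        then show ?thesis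
          using True a by (simp add: ennreal_mult exponential_density_nonneg mult.assoc)
      qed (simp add: exponential_density_def)
    qed
    also have "\<dots> = ennreal (exp (- y * a)) * (\<integral>\<^sup>+u. h u \<partial>exp_measure a)"
      by (subst nn_integral_cmult) (auto simp: nn_integral_exp_measure)
    finally show ?thesis .
  qed
  have "(\<integral>\<^sup>+y. \<integral>\<^sup>+x. (if y \<le> x then h (x - y) else 0) \<partial>exp_measure a \<partial>exp_measure b) =
      (\<integral>\<^sup>+y. ennreal (exp (- y * a)) * (\<integral>\<^sup>+u. h u \<partial>exp_measure a) \<partial>exp_measure b)"
    by (rule nn_integral_cong_AE, rule AE_mp[OF AE_exp_measure_pos[of b]], intro AE_I2 impI)
       (simp add: inner)
  also have "\<dots> = (\<integral>\<^sup>+y. ennreal (exp (- y * a)) \<partial>exp_measure b) * (\<integral>\<^sup>+u. h u \<partial>exp_measure a)"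
    by (rule nn_integral_multc) auto
  also have "(\<integral>\<^sup>+y. ennreal (exp (- y * a)) \<partial>exp_measure b) =
      (\<integral>\<^sup>+y. ennreal (b / (a + b)) * ennreal (exponential_density (a + b) y) \<partial>lborel)"
  proof -
    \<comment> \<open>The density of the earlier clock times the survival probability of the later
      one is a multiple of the density of the minimum, which has rate \<open>a + b\<close>.\<close>
    have "exponential_density b y * exp (- y * a) = b / (a + b) * exponential_density (a + b) y" for y
    proof (cases "0 \<le> y")
      case True
      have "exp (- y * b) * exp (- y * a) = exp (- y * (a + b))"
        by (simp add: exp_add[symmetric] distrib_left)
      then show ?thesis using True a b by (simp add: exponential_density_def mult.assoc)
    qed (simp add: exponential_density_def)
    then show ?thesis
      using a b by (subst nn_integral_exp_measure)
        (auto simp: ennreal_mult[symmetric] exponential_density_nonneg simp del: mult_minus_left intro!: nn_integral_cong)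
  qed
  also have "\<dots> = ennreal (b / (a + b)) * (\<integral>\<^sup>+y. 1 \<partial>exp_measure (a + b))"
    by (subst nn_integral_cmult) (simp_all add: nn_integral_exp_measure del: nn_integral_const)
  also have "(\<integral>\<^sup>+y. 1 \<partial>exp_measure (a + b)) = 1"
    using prob_space.emeasure_space_1[OF prob_space_exp_measure[of "a + b"]] a b by simp
  finally show ?thesis by simp
qed

section \<open>Sequences of independent exponential gaps\<close>

abbreviation exp_seq :: "real \<Rightarrow> (nat \<Rightarrow> real) measure" where
  "exp_seq l \<equiv> PiM UNIV (\<lambda>_. exp_measure l)"

lemma prob_space_exp_seq: "0 < l \<Longrightarrow> prob_space (exp_seq l)"
  by (intro prob_space_PiM prob_space_exp_measure)

text \<open>An i.i.d. sequence is a first entry followed by an independent copy of the sequence.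
  This peels off the first gap of either process.\<close>

lemma nn_integral_exp_seq_case_nat:
  assumes l: "0 < l" and [measurable]: "f \<in> borel_measurable (exp_seq l)"
  shows "(\<integral>\<^sup>+s. f s \<partial>exp_seq l) = (\<integral>\<^sup>+x. \<integral>\<^sup>+s. f (case_nat x s) \<partial>exp_seq l \<partial>exp_measure l)"
proof -
  interpret E: prob_space "exp_measure l" by (rule prob_space_exp_measure[OF l])
  interpret sequence_space "exp_measure l" by unfold_locales
  have "(\<integral>\<^sup>+s. f s \<partial>exp_seq l) =
      (\<integral>\<^sup>+s. f s \<partial>distr (exp_measure l \<Otimes>\<^sub>M exp_seq l) (exp_seq l) (\<lambda>(x, s). case_nat x s))"
    by (simp only: PiM_iter)
  also have "\<dots> = (\<integral>\<^sup>+z. f (case_nat (fst z) (snd z)) \<partial>(exp_measure l \<Otimes>\<^sub>M exp_seq l))"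
    by (subst nn_integral_distr) (auto simp: split_beta')
  also have "\<dots> = (\<integral>\<^sup>+x. \<integral>\<^sup>+s. f (case_nat x s) \<partial>exp_seq l \<partial>exp_measure l)"
    by (subst nn_integral_fst[symmetric]) auto
  finally show ?thesis .
qed

lemma AE_exp_seq_nonneg: "0 < l \<Longrightarrow> AE s in exp_seq l. \<forall>i. 0 \<le> s i"
  unfolding AE_all_countable
proof
  fix i assume l: "0 < l"
  have "AE x in exp_measure l. 0 \<le> x" using AE_exp_measure_pos[of l] by (rule AE_mp) auto
  then show "AE s in exp_seq l. 0 \<le> s i"
    using prob_space_exp_measure[OF l] by (intro AE_PiM_component[where P="\<lambda>x. 0 \<le> x"]) auto
qed

section \<open>Intervals without changes as functions of the gaps\<close>

text \<open>Index \<open>k\<close> stands for the interval between accesses \<open>k\<close> and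
  \<open>Suc k\<close>, so it corresponds to the indicator with index \<open>Suc k\<close>. A set of
  indices is carried along because restarting the clock at an access shifts it.\<close>

definition no_change :: "nat set \<Rightarrow> (nat \<Rightarrow> real) \<Rightarrow> (nat \<Rightarrow> real) \<Rightarrow> bool" where
  "no_change K s t \<longleftrightarrow> (\<forall>k\<in>K. \<forall>n. \<not> ((\<Sum>i<k. t i) < (\<Sum>j\<le>n. s j) \<and> (\<Sum>j\<le>n. s j) \<le> (\<Sum>i<Suc k. t i)))"

lemma sum_case_nat_lessThan: "(\<Sum>i<Suc k. case_nat (y::real) t i) = y + (\<Sum>i<k. t i)"
  by (simp only: sum.lessThan_Suc_shift nat.case)

lemma sum_case_nat_atMost: "(\<Sum>j\<le>n. case_nat (x::real) s j) = x + (\<Sum>j<n. s j)"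
  by (simp only: sum.atMost_shift nat.case)

lemma ball_nat_split: "(\<forall>k\<in>K. P k) \<longleftrightarrow> (0 \<in> K \<longrightarrow> P 0) \<and> (\<forall>k. Suc k \<in> K \<longrightarrow> P (Suc k))"
  by (metis not0_implies_Suc)

lemma all_nat_split: "(\<forall>n. P n) \<longleftrightarrow> P 0 \<and> (\<forall>n. P (Suc n))"
  by (metis not0_implies_Suc)

text \<open>All changes come after the access at \<open>y\<close>, so interval 0 is clean.
  Restarting the clock at \<open>y\<close> lowers every interval index by one and leaves the
  residual gap \<open>x - y\<close> to the first change.\<close>

lemma no_change_access_first:
  assumes "y < x" "\<forall>i. 0 \<le> s i"
  shows "no_change K (case_nat x s) (case_nat y t) \<longleftrightarrow> no_change {k. Suc k \<in> K} (case_nat (x - y) s) t"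
proof -
  have "\<not> x + (\<Sum>j<n. s j) \<le> y" for n
    using sum_nonneg[of "{..<n}" s] assms by (simp add: not_le)
  then show ?thesis
    unfolding no_change_def ball_nat_split[of K] sum_case_nat_lessThan sum_case_nat_atMost
    by (simp add: algebra_simps)
qed

text \<open>The change at \<open>x\<close> lies in interval 0 (open at 0, hence
  \<open>0 < x\<close>) and in no other. Restarting the clock at \<open>x\<close> keeps the interval
  indices and leaves the residual gap \<open>y - x\<close> to the first access.\<close>

lemma no_change_change_first:
  assumes "x < y" "0 < x" "\<forall>i. 0 \<le> t i"
  shows "no_change K (case_nat x s) (case_nat y t) \<longleftrightarrow> 0 \<notin> K \<and> no_change K s (case_nat (y - x) t)"
proof -
  have 1: "\<not> y + (\<Sum>j<n. t j) < x" for n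
    using sum_nonneg[of "{..<n}" t] assms by (simp add: not_less)
  have "no_change K (case_nat x s) (case_nat y t) \<longleftrightarrow>
     0 \<notin> K \<and> (\<forall>k. Suc k \<in> K \<longrightarrow> (\<forall>n.
        \<not> (y + (\<Sum>i<k. t i) < x + (\<Sum>j<Suc n. s j) \<and> x + (\<Sum>j<Suc n. s j) \<le> y + (\<Sum>i<Suc k. t i))))"
    unfolding no_change_def ball_nat_split[of K] sum_case_nat_lessThan sum_case_nat_atMost
      all_nat_split[of "\<lambda>n. \<not> (_ < x + (\<Sum>j<n. s j) \<and> x + (\<Sum>j<n. s j) \<le> _)"]
    using assms(1,2) 1 by simp
  also have "\<dots> \<longleftrightarrow> 0 \<notin> K \<and> no_change K s (case_nat (y - x) t)"
    unfolding no_change_def ball_nat_split[of K] sum_case_nat_lessThan lessThan_Suc_atMost[symmetric]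
    by (auto simp: algebra_simps)
  finally show ?thesis .
qed

lemma no_change_measurable [measurable]:
  "Measurable.pred (exp_seq a \<Otimes>\<^sub>M exp_seq b) (\<lambda>z. no_change K (fst z) (snd z))"
proof -
  have [measurable]: "(\<lambda>z. fst z i) \<in> borel_measurable (exp_seq a \<Otimes>\<^sub>M exp_seq b)"
    "(\<lambda>z. snd z i) \<in> borel_measurable (exp_seq a \<Otimes>\<^sub>M exp_seq b)" for i
    using measurable_compose[OF measurable_fst measurable_component_singleton[of i UNIV "\<lambda>_. exp_measure a"]]
      measurable_compose[OF measurable_snd measurable_component_singleton[of i UNIV "\<lambda>_. exp_measure b"]]
    by simp_all
  show ?thesis unfolding no_change_def Ball_def by measurable
qed

text \<open>Competing exponentials: the first event is an access with probability \<open>b / (a + b)\<close>, and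
  by memorylessness what follows it is again a pair of independent exponential sequences.\<close>
lemma nn_integral_no_change_rec:
  assumes a: "0 < a" and b: "0 < b"
  defines "A \<equiv> \<lambda>K. \<integral>\<^sup>+s. \<integral>\<^sup>+t. of_bool (no_change K s t) \<partial>exp_seq b \<partial>exp_seq a"
  shows "A K = ennreal (b / (a + b)) * A {k. Suc k \<in> K}
    + ennreal (a / (a + b)) * (if 0 \<in> K then 0 else A K)"
proof -
  interpret EA: prob_space "exp_measure a" by (rule prob_space_exp_measure[OF a])
  interpret EB: prob_space "exp_measure b" by (rule prob_space_exp_measure[OF b])
  interpret SA: prob_space "exp_seq a" by (rule prob_space_exp_seq[OF a])
  interpret SB: prob_space "exp_seq b" by (rule prob_space_exp_seq[OF b])
  interpret P1: pair_sigma_finite "exp_measure b" "exp_seq a" ..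
  interpret P2: pair_sigma_finite "exp_measure a" "exp_measure b" ..
  define F :: "nat set \<Rightarrow> (nat \<Rightarrow> real) \<Rightarrow> (nat \<Rightarrow> real) \<Rightarrow> ennreal"
    where "F K s t = of_bool (no_change K s t)" for K s t
  have F_meas [measurable (raw)]: "(\<lambda>x. F K (f x) (g x)) \<in> borel_measurable N"
    if [measurable]: "f \<in> measurable N (exp_seq a)" "g \<in> measurable N (exp_seq b)" for N K and f g :: "'b \<Rightarrow> _"
  proof -
    have "(\<lambda>z. of_bool (no_change K (fst z) (snd z)) :: ennreal) \<in> borel_measurable (exp_seq a \<Otimes>\<^sub>M exp_seq b)"
      by measurable
    from measurable_compose[OF measurable_Pair[OF that] this] show ?thesis by (simp add: F_def)
  qed
  have F_meas' [measurable]: "F K s \<in> borel_measurable (exp_seq b)" for K s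
    using F_meas[of "\<lambda>_. s" "exp_seq b" "\<lambda>t. t" K] by (simp add: space_PiM)
  \<comment> \<open>\<open>G1\<close> and \<open>G2\<close> are the probabilities for the restarted
    pair, given the residual gap \<open>u\<close> to the first change (after an access) or to the
    first access (after a change).\<close>
  define G1 where "G1 u = (\<integral>\<^sup>+s. \<integral>\<^sup>+t. F {k. Suc k \<in> K} (case_nat u s) t \<partial>exp_seq b \<partial>exp_seq a)" for u
  define G2 where "G2 u = (\<integral>\<^sup>+s. \<integral>\<^sup>+t. F K s (case_nat u t) \<partial>exp_seq b \<partial>exp_seq a)" for u
  have [measurable]: "G1 \<in> borel_measurable borel" "G2 \<in> borel_measurable borel"
    unfolding G1_def G2_def by measurable
  have A1: "A {k. Suc k \<in> K} = (\<integral>\<^sup>+u. G1 u \<partial>exp_measure a)"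
    unfolding A_def G1_def F_def[symmetric] by (subst nn_integral_exp_seq_case_nat[OF a]) auto
  have "A K = (\<integral>\<^sup>+s. \<integral>\<^sup>+y. \<integral>\<^sup>+t. F K s (case_nat y t) \<partial>exp_seq b \<partial>exp_measure b \<partial>exp_seq a)"
    unfolding A_def F_def[symmetric] by (subst nn_integral_exp_seq_case_nat[OF b]) auto
  also have "\<dots> = (\<integral>\<^sup>+u. G2 u \<partial>exp_measure b)"
    unfolding G2_def by (rule P1.Fubini') measurable
  finally have A2: "A K = (\<integral>\<^sup>+u. G2 u \<partial>exp_measure b)" .
  have "A K = (\<integral>\<^sup>+x. \<integral>\<^sup>+s. \<integral>\<^sup>+t. F K (case_nat x s) t \<partial>exp_seq b \<partial>exp_seq a \<partial>exp_measure a)"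
    unfolding A_def F_def[symmetric] by (subst nn_integral_exp_seq_case_nat[OF a]) auto
  also have "\<dots> = (\<integral>\<^sup>+x. \<integral>\<^sup>+s. \<integral>\<^sup>+y. \<integral>\<^sup>+t. F K (case_nat x s) (case_nat y t) \<partial>exp_seq b \<partial>exp_measure b \<partial>exp_seq a \<partial>exp_measure a)"
    by (subst nn_integral_exp_seq_case_nat[OF b]) auto
  also have "\<dots> = (\<integral>\<^sup>+x. \<integral>\<^sup>+y. \<integral>\<^sup>+s. \<integral>\<^sup>+t. F K (case_nat x s) (case_nat y t) \<partial>exp_seq b \<partial>exp_seq a \<partial>exp_measure b \<partial>exp_measure a)"
    by (intro nn_integral_cong P1.Fubini') measurable
  also have "\<dots> = (\<integral>\<^sup>+x. \<integral>\<^sup>+y. (if y \<le> x then G1 (x - y) else 0)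
      + (if 0 \<in> K then 0 else if x \<le> y then G2 (y - x) else 0) \<partial>exp_measure b \<partial>exp_measure a)"
  proof (rule nn_integral_cong_AE, rule AE_mp[OF AE_exp_measure_pos[of a]], intro AE_I2 impI)
    fix x :: real assume x: "0 < x"
    show "(\<integral>\<^sup>+y. \<integral>\<^sup>+s. \<integral>\<^sup>+t. F K (case_nat x s) (case_nat y t) \<partial>exp_seq b \<partial>exp_seq a \<partial>exp_measure b) =
      (\<integral>\<^sup>+y. (if y \<le> x then G1 (x - y) else 0)
      + (if 0 \<in> K then 0 else if x \<le> y then G2 (y - x) else 0) \<partial>exp_measure b)"
    \<comment> \<open>Ties \<open>x = y\<close> fall under both summands, but they form a null
      set.\<close>
    proof (rule nn_integral_cong_AE, rule AE_mp[OF AE_exp_measure_neq[where l=b and c=x]], intro AE_I2 impI)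
      fix y :: real assume "y \<noteq> x"
      then consider "y < x" | "x < y" by linarith
      then show "(\<integral>\<^sup>+s. \<integral>\<^sup>+t. F K (case_nat x s) (case_nat y t) \<partial>exp_seq b \<partial>exp_seq a) =
        (if y \<le> x then G1 (x - y) else 0) + (if 0 \<in> K then 0 else if x \<le> y then G2 (y - x) else 0)"
      proof cases
        case 1
        have "(\<integral>\<^sup>+s. \<integral>\<^sup>+t. F K (case_nat x s) (case_nat y t) \<partial>exp_seq b \<partial>exp_seq a) = G1 (x - y)"
          unfolding G1_def F_def
          by (rule nn_integral_cong_AE, rule AE_mp[OF AE_exp_seq_nonneg[OF a]], intro AE_I2 impI)
             (simp add: no_change_access_first[OF 1])
        with 1 show ?thesis by simp
      next
        case 2
        have "(\<integral>\<^sup>+s. \<integral>\<^sup>+t. F K (case_nat x s) (case_nat y t) \<partial>exp_seq b \<partial>exp_seq a) = (if 0 \<in> K then 0 else G2 (y - x))"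
        proof -
          have "(\<integral>\<^sup>+t. F K (case_nat x s) (case_nat y t) \<partial>exp_seq b) =
            (\<integral>\<^sup>+t. (if 0 \<in> K then 0 else F K s (case_nat (y - x) t)) \<partial>exp_seq b)" for s
            by (rule nn_integral_cong_AE, rule AE_mp[OF AE_exp_seq_nonneg[OF b]], intro AE_I2 impI)
               (simp add: F_def no_change_change_first[OF 2 x])
          then show ?thesis by (simp add: G2_def)
        qed
        with 2 show ?thesis by simp
      qed
    qed
  qed
  also have "\<dots> = (\<integral>\<^sup>+x. (\<integral>\<^sup>+y. (if y \<le> x then G1 (x - y) else 0) \<partial>exp_measure b)
      + (\<integral>\<^sup>+y. (if 0 \<in> K then 0 else if x \<le> y then G2 (y - x) else 0) \<partial>exp_measure b) \<partial>exp_measure a)"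
    by (intro nn_integral_cong nn_integral_add) measurable
  also have "\<dots> = (\<integral>\<^sup>+x. \<integral>\<^sup>+y. (if y \<le> x then G1 (x - y) else 0) \<partial>exp_measure b \<partial>exp_measure a)
      + (\<integral>\<^sup>+x. \<integral>\<^sup>+y. (if 0 \<in> K then 0 else if x \<le> y then G2 (y - x) else 0) \<partial>exp_measure b \<partial>exp_measure a)"
    by (rule nn_integral_add) measurable
  \<comment> \<open>Memorylessness is stated with the later time as the inner variable, so the
    integrals are exchanged here.\<close>
  also have "(\<integral>\<^sup>+x. \<integral>\<^sup>+y. (if y \<le> x then G1 (x - y) else 0) \<partial>exp_measure b \<partial>exp_measure a) =
      (\<integral>\<^sup>+y. \<integral>\<^sup>+x. (if y \<le> x then G1 (x - y) else 0) \<partial>exp_measure a \<partial>exp_measure b)"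
    by (rule P2.Fubini'[symmetric]) measurable
  also have "\<dots> = ennreal (b / (a + b)) * A {k. Suc k \<in> K}"
    unfolding A1 by (rule nn_integral_exp_memoryless[OF a b]) measurable
  also have "(\<integral>\<^sup>+x. \<integral>\<^sup>+y. (if 0 \<in> K then 0 else if x \<le> y then G2 (y - x) else 0) \<partial>exp_measure b \<partial>exp_measure a) =
      ennreal (a / (a + b)) * (if 0 \<in> K then 0 else A K)"
    using nn_integral_exp_memoryless[OF b a, of G2] by (simp add: A2 add.commute)
  finally show ?thesis .
qed

text \<open>The recursion is iterated by shifting \<open>K\<close> down until it is empty. An index
  0 in \<open>K\<close> costs a factor \<open>r\<close>; otherwise the value for \<open>K\<close>
  occurs on both sides and cancels to that of the shifted set.\<close>

lemma nn_integral_no_change: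
  assumes a: "0 < a" and b: "0 < b" and "finite K"
  shows "(\<integral>\<^sup>+s. \<integral>\<^sup>+t. of_bool (no_change K s t) \<partial>exp_seq b \<partial>exp_seq a) = ennreal ((b / (a + b)) ^ card K)"
proof -
  interpret SA: prob_space "exp_seq a" by (rule prob_space_exp_seq[OF a])
  interpret SB: prob_space "exp_seq b" by (rule prob_space_exp_seq[OF b])
  define A where "A K = (\<integral>\<^sup>+s. \<integral>\<^sup>+t. of_bool (no_change K s t) \<partial>exp_seq b \<partial>exp_seq a)" for K
  define r where "r = b / (a + b)"
  have r: "0 < r" "a / (a + b) = 1 - r" "r \<le> 1" using a b by (auto simp: r_def field_simps)
  note rec = nn_integral_no_change_rec[OF a b, folded A_def r_def, unfolded r]
  have le1: "A K \<le> 1" for K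
  proof -
    have "A K \<le> (\<integral>\<^sup>+s. \<integral>\<^sup>+t. 1 \<partial>exp_seq b \<partial>exp_seq a)"
      unfolding A_def by (intro nn_integral_mono) auto
    then show ?thesis by (simp add: SA.emeasure_space_1 SB.emeasure_space_1)
  qed
  \<comment> \<open>The values are at most 1, so they can be moved to the reals, where the
    cancellation is possible.\<close>
  define R where "R K = enn2real (A K)" for K
  have AR: "A K = ennreal (R K)" for K
    unfolding R_def using le1[of K] by (metis ennreal_enn2real ennreal_one_less_top order_le_less_trans)
  have R0: "0 \<le> R K" for K by (simp add: R_def)
  have R: "R K = r * R {k. Suc k \<in> K} + (1 - r) * (if 0 \<in> K then 0 else R K)" for K
  proof -
    have "ennreal (R K) = ennreal (r * R {k. Suc k \<in> K} + (1 - r) * (if 0 \<in> K then 0 else R K))"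
      using rec[of K] r R0 unfolding AR by (auto simp: ennreal_mult[symmetric] ennreal_plus[symmetric] simp del: ennreal_plus)
    then show ?thesis using r R0 by (subst (asm) ennreal_inj) auto
  qed
  have "R K = r ^ card K" if "K \<subseteq> {..<n}" for n
    using that
  proof (induction n arbitrary: K)
    case 0
    then have "K = {}" by auto
    then show ?case by (simp add: R_def A_def no_change_def SA.emeasure_space_1 SB.emeasure_space_1)
  next
    case (Suc n)
    let ?K = "{k. Suc k \<in> K}"
    have IH: "R ?K = r ^ card ?K" using Suc.prems by (intro Suc.IH) auto
    have fin: "finite ?K" using Suc.prems by (intro finite_subset[of ?K "{..<n}"]) auto
    have im: "card (Suc ` ?K) = card ?K" by (rule card_image) simp
    show ?case
    proof (cases "0 \<in> K")
      case True
      then have "K = insert 0 (Suc ` ?K)" by (auto simp: image_iff) (metis not0_implies_Suc)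
      then have "card K = Suc (card (Suc ` ?K))"
        using fin by (metis card_insert_disjoint finite_imageI imageE nat.distinct(1))
      then show ?thesis using R[of K] IH im True by simp
    next
      case False
      then have "K = Suc ` ?K" by (auto simp: image_iff) (metis not0_implies_Suc)
      then have "card K = card ?K" using im by simp
      moreover have "r * R K = r * R ?K" using R[of K] False by (simp add: algebra_simps)
      ultimately show ?thesis using IH r by simp
    qed
  qed
  moreover obtain n where "K \<subseteq> {..<n}" using finite_nat_iff_bounded assms(3) by blast
  ultimately show ?thesis unfolding A_def[symmetric] AR r_def[symmetric] by simp
qed

section \<open>Transfer to the given probability space\<close>

text \<open>Applied to \<open>Inl\<close> and \<open>Inr\<close>, this extracts the independence of
  \<open>S\<close> and of \<open>tau\<close> from that of the joint family
  \<open>case_sum S tau\<close>.\<close>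

lemma (in prob_space) indep_vars_reindex_inj:
  assumes ind: "indep_vars M' X UNIV" and f: "inj f"
  shows "indep_vars (\<lambda>i. M' (f i)) (\<lambda>i. X (f i)) UNIV"
  unfolding indep_vars_def2
proof (intro conjI ballI)
  fix i show "random_variable (M' (f i)) (X (f i))"
    using ind by (auto simp: indep_vars_def2)
next
  let ?F = "\<lambda>i. {X i -` A \<inter> space M | A. A \<in> sets (M' i)}"
  have F: "indep_sets ?F UNIV" using ind by (auto simp: indep_vars_def2)
  show "indep_sets (\<lambda>i. ?F (f i)) UNIV"
  proof (rule indep_setsI)
    fix i show "?F (f i) \<subseteq> events" using F by (auto simp: indep_sets_def)
  next
    fix A J assume J: "J \<noteq> {}" "J \<subseteq> UNIV" "finite J" "\<forall>j\<in>J. A j \<in> ?F (f j)"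
    have "prob (\<Inter>i\<in>f ` J. A (inv f i)) = (\<Prod>i\<in>f ` J. prob (A (inv f i)))"
      by (rule indep_setsD[OF F]) (use J f in auto)
    then show "prob (\<Inter>j\<in>J. A j) = (\<Prod>j\<in>J. prob (A j))"
      using f by (simp add: prod.reindex[OF inj_on_subset[OF f subset_UNIV]])
  qed
qed

context
  fixes M :: "'a measure" and S tau :: "nat \<Rightarrow> 'a \<Rightarrow> real" and a b :: real
  assumes M: "prob_space M" and a: "0 < a" and b: "0 < b"
    and S: "\<And>j. distributed M lborel (S j) (exponential_density a)"
    and tau: "\<And>k. distributed M lborel (tau k) (exponential_density b)"
    and indep: "prob_space.indep_vars M (\<lambda>_. borel) (case_sum S tau) UNIV"
begin

interpretation prob_space M by (rule M)

lemma S_measurable: "S j \<in> borel_measurable M"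
  using distributed_measurable[OF S[of j]] by simp

lemma tau_measurable: "tau j \<in> borel_measurable M"
  using distributed_measurable[OF tau[of j]] by simp

text \<open>Each family has a product law by its own independence, and the two sequences are
  independent of each other as functions of disjoint blocks of
  \<open>case_sum S tau\<close>.\<close>

lemma distr_pair_exp_seq:
  "distr M (exp_seq a \<Otimes>\<^sub>M exp_seq b) (\<lambda>\<omega>. (\<lambda>n. S n \<omega>, \<lambda>n. tau n \<omega>)) = exp_seq a \<Otimes>\<^sub>M exp_seq b"
proof -
  let ?B = "PiM (UNIV :: nat set) (\<lambda>_. borel :: real measure)"
  have seq: "distr M ?B (\<lambda>\<omega> n. X n \<omega>) = exp_seq l"
    if X: "\<And>j. distributed M lborel (X j) (exponential_density l)" "indep_vars (\<lambda>_. borel) X UNIV"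
    for X and l
  proof -
    have "distr M borel (X j) = exp_measure l" for j
    proof -
      have "distr M borel (X j) = distr M lborel (X j)" by (rule distr_cong) auto
      then show ?thesis using distributed_distr_eq_density[OF X(1)[of j]] by (simp add: exp_measure_def)
    qed
    moreover have "X j \<in> borel_measurable M" for j
      using distributed_measurable[OF X(1)[of j]] by simp
    ultimately show ?thesis
      using indep_vars_iff_distr_eq_PiM[of UNIV X "\<lambda>_. borel"] X(2) by (simp add: restrict_UNIV)
  qed
  have "indep_var ?B ((\<lambda>f n. f (Inl n)) \<circ> (\<lambda>\<omega>. \<lambda>i\<in>range Inl. case_sum S tau i \<omega>))
      ?B ((\<lambda>f n. f (Inr n)) \<circ> (\<lambda>\<omega>. \<lambda>i\<in>range Inr. case_sum S tau i \<omega>))"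
    by (intro indep_var_compose[OF indep_var_restrict[OF indep]])
       (auto intro!: measurable_PiM_single' measurable_component_singleton)
  then have "indep_var ?B (\<lambda>\<omega> n. S n \<omega>) ?B (\<lambda>\<omega> n. tau n \<omega>)" by (simp add: comp_def)
  then have "distr M (?B \<Otimes>\<^sub>M ?B) (\<lambda>\<omega>. (\<lambda>n. S n \<omega>, \<lambda>n. tau n \<omega>)) =
      distr M ?B (\<lambda>\<omega> n. S n \<omega>) \<Otimes>\<^sub>M distr M ?B (\<lambda>\<omega> n. tau n \<omega>)"
    unfolding indep_var_distribution_eq by simp
  also have "distr M ?B (\<lambda>\<omega> n. S n \<omega>) = exp_seq a"
    using indep_vars_reindex_inj[OF indep, of Inl] by (intro seq S) simp
  also have "distr M ?B (\<lambda>\<omega> n. tau n \<omega>) = exp_seq b"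
    using indep_vars_reindex_inj[OF indep, of Inr] by (intro seq tau) simp
  \<comment> \<open>\<open>?B\<close> and the exponential sequence spaces have the same measurable
    sets, so the target space may be exchanged.\<close>
  also have "distr M (?B \<Otimes>\<^sub>M ?B) (\<lambda>\<omega>. (\<lambda>n. S n \<omega>, \<lambda>n. tau n \<omega>)) =
      distr M (exp_seq a \<Otimes>\<^sub>M exp_seq b) (\<lambda>\<omega>. (\<lambda>n. S n \<omega>, \<lambda>n. tau n \<omega>))"
    by (rule distr_cong) (auto intro!: sets_pair_measure_cong sets_PiM_cong)
  finally show ?thesis .
qed

text \<open>A product of the indicators over \<open>K\<close> is the indicator of
  \<open>no_change K\<close> at the gap sequences, so its expectation depends only on their joint
  law and is the integral computed above.\<close>

lemma bernoulli_moments_unchanged: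
  "bernoulli_moments M (\<lambda>k \<omega>. 1 - changed_ind S tau (Suc k) \<omega>) (b / (a + b))"
proof unfold_locales
  note [measurable] = S_measurable tau_measurable
  let ?J = "\<lambda>k \<omega>. 1 - changed_ind S tau (Suc k) \<omega>"
  show J_meas: "?J k \<in> borel_measurable M" for k
    unfolding changed_ind_def access_time_def change_time_def by measurable
  show "?J k \<omega> = 0 \<or> ?J k \<omega> = 1" for k \<omega> by (simp add: changed_ind_def)
  fix K :: "nat set" assume K: "finite K"
  interpret SB: prob_space "exp_seq b" by (rule prob_space_exp_seq[OF b])
  let ?P = "\<lambda>\<omega>. (\<lambda>n. S n \<omega>, \<lambda>n. tau n \<omega>)"
  have J1: "?J k \<omega> = of_bool (no_change {k} (\<lambda>n. S n \<omega>) (\<lambda>n. tau n \<omega>))" for k \<omega>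
    by (simp add: changed_ind_def no_change_def access_time_def change_time_def)
  have "(\<Prod>k\<in>K. ?J k \<omega>) = of_bool (no_change K (\<lambda>n. S n \<omega>) (\<lambda>n. tau n \<omega>))" for \<omega>
    using K unfolding J1 by (induction K rule: finite_induct) (auto simp: no_change_def)
  then have J: "(\<lambda>\<omega>. \<Prod>k\<in>K. ?J k \<omega>) = (\<lambda>\<omega>. of_bool (no_change K (fst (?P \<omega>)) (snd (?P \<omega>))))" by simp
  have P_meas: "?P \<in> measurable M (exp_seq a \<Otimes>\<^sub>M exp_seq b)"
  proof -
    have "(\<lambda>\<omega> n. S n \<omega>) \<in> measurable M (exp_seq a)" "(\<lambda>\<omega> n. tau n \<omega>) \<in> measurable M (exp_seq b)"
      by (auto intro!: measurable_PiM_single' simp: measurable_cong_sets[OF refl sets_exp_measure])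
    then show ?thesis by measurable
  qed
  have "(\<integral>\<^sup>+\<omega>. ennreal (\<Prod>k\<in>K. ?J k \<omega>) \<partial>M) = (\<integral>\<^sup>+\<omega>. of_bool (no_change K (fst (?P \<omega>)) (snd (?P \<omega>))) \<partial>M)"
    by (intro nn_integral_cong) (simp only: fun_cong[OF J], simp)
  also have "\<dots> = (\<integral>\<^sup>+z. of_bool (no_change K (fst z) (snd z)) \<partial>distr M (exp_seq a \<Otimes>\<^sub>M exp_seq b) ?P)"
    using P_meas by (subst nn_integral_distr) auto
  also have "\<dots> = (\<integral>\<^sup>+s. \<integral>\<^sup>+t. of_bool (no_change K s t) \<partial>exp_seq b \<partial>exp_seq a)"
    unfolding distr_pair_exp_seq
    by (subst SB.nn_integral_fst[symmetric]) auto
  also have "\<dots> = ennreal ((b / (a + b)) ^ card K)" by (rule nn_integral_no_change[OF a b K])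
  finally have "(\<integral>\<^sup>+\<omega>. ennreal (\<Prod>k\<in>K. ?J k \<omega>) \<partial>M) = ennreal ((b / (a + b)) ^ card K)" .
  moreover have "(\<lambda>\<omega>. \<Prod>k\<in>K. ?J k \<omega>) \<in> borel_measurable M" using J_meas by measurable
  moreover have "0 \<le> (\<Prod>k\<in>K. ?J k \<omega>)" for \<omega> using fun_cong[OF J, of \<omega>] by simp
  ultimately show "expectation (\<lambda>\<omega>. \<Prod>k\<in>K. ?J k \<omega>) = (b / (a + b)) ^ card K"
    using a b by (subst integral_eq_nn_integral) auto
qed

end

subsection \<open>The estimator\<close>

lemma filterlim_sum_at_top_if_not_summable:
  fixes f :: "nat \<Rightarrow> real"
  assumes f: "\<And>k. 0 \<le> f k" and "\<not> summable f"
  shows "filterlim (\<lambda>n. \<Sum>k<n. f k) at_top sequentially"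
  unfolding filterlim_at_top eventually_sequentially
proof
  fix Z
  obtain N where N: "Z < (\<Sum>k<N. f k)"
    using summableI_nonneg_bounded[of f Z] assms by (meson not_le)
  have "Z \<le> (\<Sum>k<n. f k)" if "N \<le> n" for n
    using sum_mono2[of "{..<n}" "{..<N}" f] f that N by force
  then show "\<exists>N. \<forall>n\<ge>N. Z \<le> (\<Sum>k<n. f k)" by blast
qed

text \<open>Induction on \<open>m k \<le> B * \<eta> k\<close>. The contraction gains
  \<open>3/2 * r * B * (\<eta> k)\<^sup>2\<close>; the noise uses up
  \<open>r * B * (\<eta> k)\<^sup>2\<close>, and the remaining half pays for the decrease of
  \<open>\<eta>\<close>, which is of smaller order than \<open>(\<eta> k)\<^sup>2\<close> because
  \<open>c < 1\<close>.\<close>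

lemma powr_recursion_bound:
  fixes m :: "nat \<Rightarrow> real"
  assumes c: "0 < c" "c < 1" and r: "0 < r" "r \<le> 1"
  defines "\<eta> \<equiv> \<lambda>k. 1 / (real k + 1) powr c"
  assumes rec: "\<And>k. m (Suc k) \<le> (1 - 2 * r * \<eta> k + 2 * r * (\<eta> k)\<^sup>2) * m k + C * (\<eta> k)\<^sup>2"
  obtains B N where "0 < B" "\<And>k. N \<le> k \<Longrightarrow> m k \<le> B * \<eta> k"
proof -
  have \<eta>_pos: "0 < \<eta> k" for k by (simp add: \<eta>_def)
  have \<eta>_Suc: "\<eta> k - \<eta> k / (real k + 1) \<le> \<eta> (Suc k)" for k
  proof -
    \<comment> \<open>The left side is \<open>(real k + 1) * \<eta> k\<close>, which is therefore
      nondecreasing in \<open>k\<close>.\<close>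
    have "(real k + 1) powr (1 - c) \<le> (real k + 2) powr (1 - c)" using c by (intro powr_mono2) auto
    then have "(real k + 1) * \<eta> k \<le> (real k + 2) * \<eta> (Suc k)"
      by (simp add: \<eta>_def powr_diff add.commute)
    then have "(real k + 1) / (real k + 2) * \<eta> k \<le> \<eta> (Suc k)" by (simp add: field_simps)
    moreover have "1 - 1 / (real k + 1) \<le> (real k + 1) / (real k + 2)" by (simp add: field_simps)
    then have "(1 - 1 / (real k + 1)) * \<eta> k \<le> (real k + 1) / (real k + 2) * \<eta> k"
      using \<eta>_pos[of k] by (intro mult_right_mono) auto
    ultimately show ?thesis by (simp add: left_diff_distrib)
  qed
  have top: "filterlim (\<lambda>k. real k + 1) at_top sequentially"
    using filterlim_tendsto_add_at_top[OF tendsto_const[of 1] filterlim_real_sequentially] by (simp add: add.commute)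
  have "\<eta> \<longlonglongrightarrow> 0"
    using tendsto_neg_powr[OF _ top, of "- c"] c by (simp add: \<eta>_def powr_minus_divide)
  then have "eventually (\<lambda>k. \<eta> k < 1 / 4) sequentially" by (rule order_tendstoD) simp
  moreover have "(\<lambda>k. (real k + 1) powr (c - 1)) \<longlonglongrightarrow> 0"
    using c by (intro tendsto_neg_powr[OF _ top]) simp
  then have "eventually (\<lambda>k. (real k + 1) powr (c - 1) < r / 2) sequentially" using r by (intro order_tendstoD) auto
  ultimately have "eventually (\<lambda>k. \<eta> k < 1 / 4 \<and> (real k + 1) powr (c - 1) < r / 2) sequentially"
    by (rule eventually_conj)
  \<comment> \<open>The first threshold gives
    \<open>2 * r * (\<eta> k)\<^sup>2 \<le> r / 2 * \<eta> k\<close> and a nonnegative contraction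
    factor; the second one says \<open>1 / (real k + 1) \<le> r / 2 * \<eta> k\<close>.\<close>
  then obtain N where N: "\<And>k. N \<le> k \<Longrightarrow> \<eta> k < 1 / 4" "\<And>k. N \<le> k \<Longrightarrow> (real k + 1) powr (c - 1) < r / 2"
    by (auto simp: eventually_sequentially)
  \<comment> \<open>The three entries give positivity, \<open>C \<le> r * B\<close> for the noise,
    and the base case at \<open>N\<close>.\<close>
  define B where "B = Max {1, C / r, m N / \<eta> N}"
  have B: "1 \<le> B" "C / r \<le> B" "m N / \<eta> N \<le> B" by (auto simp: B_def)
  have "m k \<le> B * \<eta> k" if "N \<le> k" for k
    using that
  proof (induction k rule: dec_induct)
    case base
    then show ?case using B(3) \<eta>_pos[of N] by (simp add: field_simps)
  next
    case (step k)
    let ?e = "\<eta> k"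
    have e: "0 < ?e" "?e < 1 / 4" using \<eta>_pos N(1)[OF step.hyps(1)] by auto
    have "1 / (real k + 1) \<le> r / 2 * ?e"
      using N(2)[OF step.hyps(1)] by (simp add: \<eta>_def powr_diff field_simps)
    then have "B * ?e * (1 / (real k + 1)) \<le> B * ?e * (r / 2 * ?e)"
      using B(1) e by (intro mult_left_mono) auto
    then have slow: "B * (?e / (real k + 1)) \<le> r / 2 * B * ?e\<^sup>2" by (simp add: power2_eq_square mult_ac)
    have "?e * ?e \<le> 1 / 4 * ?e" using e by (intro mult_right_mono) auto
    then have e2: "r * ?e\<^sup>2 \<le> r * (1 / 4 * ?e)" using r by (intro mult_left_mono) (auto simp: power2_eq_square)
    have "r * ?e \<le> 1 * (1 / 4)" using e r by (intro mult_mono) auto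
    then have nonneg: "0 \<le> 1 - 2 * r * ?e + 2 * r * ?e\<^sup>2" using r by (simp add: add_nonneg_nonneg)
    have "m (Suc k) \<le> (1 - 2 * r * ?e + 2 * r * ?e\<^sup>2) * (B * ?e) + C * ?e\<^sup>2"
      using rec[of k] mult_left_mono[OF step.IH nonneg] by simp
    also have "\<dots> \<le> (1 - 3 / 2 * (r * ?e)) * (B * ?e) + (r * B) * ?e\<^sup>2"
      using e2 B e r by (intro add_mono mult_right_mono) (auto simp: field_simps)
    also have "\<dots> = B * ?e - r / 2 * B * ?e\<^sup>2" by (simp add: power2_eq_square algebra_simps)
    also have "\<dots> \<le> B * (?e - ?e / (real k + 1))" using slow by (simp add: right_diff_distrib)
    also have "\<dots> \<le> B * \<eta> (Suc k)" using \<eta>_Suc B(1) by (intro mult_left_mono) auto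
    finally show ?case .
  qed
  then show thesis using B(1) by (intro that[of B N]) auto
qed

section \<open>Almost sure convergence and rate of the error\<close>

context bernoulli_moments
begin

context
  fixes \<Delta> p y0 :: real and eta :: "nat \<Rightarrow> real" and I :: "nat \<Rightarrow> 'a \<Rightarrow> real"
  assumes pos: "0 < \<Delta>" "0 < p" and r: "r = p / (\<Delta> + p)"
    and I: "\<And>k \<omega>. I (Suc k) \<omega> = 1 - J k \<omega>" and eta: "\<And>k. 0 < eta k"
begin

lemma AE_SA_est_tendsto:
  assumes "\<not> summable eta" and sq: "summable (\<lambda>k. (eta k)\<^sup>2)"
  shows "AE \<omega> in M. (\<lambda>k. SA_est eta p y0 (\<lambda>i. I i \<omega>) k) \<longlonglongrightarrow> \<Delta>"
proof (rule AE_mp[OF AE_summable_centered[OF sq]], intro AE_I2 impI)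
  fix \<omega> assume summ: "summable (\<lambda>k. eta k * (J k \<omega> - r))"
  let ?z = "\<lambda>k. SA_est eta p y0 (\<lambda>i. I i \<omega>) k - \<Delta>"
  \<comment> \<open>This identity makes \<open>\<Delta>\<close> the zero of the mean drift.\<close>
  have rp: "(\<Delta> + p) * r = p" using pos by (simp add: r)
  have "?z \<longlonglongrightarrow> 0"
  proof (rule perturbed_contraction_tendsto_0)
    show "?z (Suc k) = (1 - eta k * J k \<omega>) * ?z k + - (\<Delta> + p) * (eta k * (J k \<omega> - r))" for k
    proof -
      have "- (\<Delta> + p) * (eta k * (J k \<omega> - r)) = eta k * (p - (\<Delta> + p) * J k \<omega>)"
        by (subst rp[symmetric]) (simp add: algebra_simps)
      then show ?thesis by (simp add: I algebra_simps)
    qed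
    have "(\<lambda>k. (eta k)\<^sup>2) \<longlonglongrightarrow> 0" by (rule summable_LIMSEQ_zero[OF sq])
    then have "eventually (\<lambda>k. (eta k)\<^sup>2 < 1) sequentially" by (rule order_tendstoD) simp
    then show "eventually (\<lambda>k. 0 \<le> eta k * J k \<omega> \<and> eta k * J k \<omega> \<le> 1) sequentially"
    proof (rule eventually_mono)
      fix k assume "(eta k)\<^sup>2 < 1"
      then have "eta k < 1" using eta[of k] by (simp add: power_less_one_iff abs_square_less_1)
      then show "0 \<le> eta k * J k \<omega> \<and> eta k * J k \<omega> \<le> 1" using J_01[of k \<omega>] eta[of k] by auto
    qed
    \<comment> \<open>The random steps \<open>eta k * J k \<omega>\<close> sum to a convergent
      centred part plus \<open>r\<close> times the divergent sum of \<open>eta\<close>.\<close>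
    have "filterlim (\<lambda>n. r * (\<Sum>k<n. eta k)) at_top sequentially"
      using pos assms(1) eta[THEN less_imp_le]
      by (intro filterlim_tendsto_pos_mult_at_top[OF tendsto_const] filterlim_sum_at_top_if_not_summable) (auto simp: r)
    then have "filterlim (\<lambda>n. (\<Sum>k<n. eta k * (J k \<omega> - r)) + r * (\<Sum>k<n. eta k)) at_top sequentially"
      by (rule filterlim_tendsto_add_at_top[OF summable_LIMSEQ[OF summ]])
    also have "(\<lambda>n. (\<Sum>k<n. eta k * (J k \<omega> - r)) + r * (\<Sum>k<n. eta k)) = (\<lambda>n. \<Sum>k<n. eta k * J k \<omega>)"
      by (simp add: sum_distrib_left sum.distrib[symmetric] algebra_simps)
    finally show "filterlim (\<lambda>n. \<Sum>k<n. eta k * J k \<omega>) at_top sequentially" .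
    show "summable (\<lambda>k. - (\<Delta> + p) * (eta k * (J k \<omega> - r)))" by (rule summable_mult[OF summ])
  qed
  then show "(\<lambda>k. SA_est eta p y0 (\<lambda>i. I i \<omega>) k) \<longlonglongrightarrow> \<Delta>" by (rule LIM_zero_cancel)
qed

lemma SA_est_eq_adapted_path:
  "SA_est eta p y0 (\<lambda>i. I i \<omega>) n =
    adapted_path (\<lambda>k y j. y + eta k * ((1 - j) * (y + p) - y)) y0 (\<lambda>k. J k \<omega>) n"
  by (induction n) (simp_all add: I)

text \<open>Averaging the two branches cancels the term linear in both the error and the step, since
  \<open>(1 - r) * p = r * \<Delta>\<close>. The remaining cross term, of order
  \<open>(eta k)\<^sup>2\<close>, is split by
  \<open>2 * z * \<Delta> \<le> z\<^sup>2 + \<Delta>\<^sup>2\<close>, which accounts for the factors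
  2 next to \<open>(eta k)\<^sup>2\<close> and \<open>\<Delta>\<^sup>2\<close>.\<close>

lemma SA_est_second_moment_rec:
  "expectation (\<lambda>\<omega>. (SA_est eta p y0 (\<lambda>i. I i \<omega>) (Suc k) - \<Delta>)\<^sup>2) \<le>
    (1 - 2 * r * eta k + 2 * r * (eta k)\<^sup>2) * expectation (\<lambda>\<omega>. (SA_est eta p y0 (\<lambda>i. I i \<omega>) k - \<Delta>)\<^sup>2)
    + (2 * r * \<Delta>\<^sup>2 + (1 - r) * p\<^sup>2) * (eta k)\<^sup>2"
proof -
  define f where "f k y j = y + eta k * ((1 - j) * (y + p) - y)" for k and y j :: real
  let ?y = "\<lambda>\<omega>. adapted_path f y0 (\<lambda>k. J k \<omega>) k"
  let ?A = "1 - 2 * r * eta k + 2 * r * (eta k)\<^sup>2" and ?C = "(2 * r * \<Delta>\<^sup>2 + (1 - r) * p\<^sup>2) * (eta k)\<^sup>2"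
  have rp: "(1 - r) * p = r * \<Delta>" using pos by (simp add: r field_simps)
  have "r * (f k y 1 - \<Delta>)\<^sup>2 + (1 - r) * (f k y 0 - \<Delta>)\<^sup>2 \<le> ?A * (y - \<Delta>)\<^sup>2 + ?C" for y
  proof -
    define z e where "z = y - \<Delta>" and "e = eta k"
    have "r * (f k y 1 - \<Delta>)\<^sup>2 + (1 - r) * (f k y 0 - \<Delta>)\<^sup>2 =
        r * ((1 - e) * z - e * \<Delta>)\<^sup>2 + (1 - r) * (z + e * p)\<^sup>2"
      by (simp add: f_def z_def e_def algebra_simps)
    also have "\<dots> = (1 - 2 * r * e + r * e\<^sup>2) * z\<^sup>2 + 2 * e * z * ((1 - r) * p - r * \<Delta>)
        + r * e\<^sup>2 * (2 * z * \<Delta>) + (r * \<Delta>\<^sup>2 + (1 - r) * p\<^sup>2) * e\<^sup>2"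
      by (simp add: power2_eq_square algebra_simps)
    also have "\<dots> = (1 - 2 * r * e + r * e\<^sup>2) * z\<^sup>2
        + r * e\<^sup>2 * (2 * z * \<Delta>) + (r * \<Delta>\<^sup>2 + (1 - r) * p\<^sup>2) * e\<^sup>2"
      by (simp add: rp)
    also have "r * e\<^sup>2 * (2 * z * \<Delta>) \<le> r * e\<^sup>2 * (z\<^sup>2 + \<Delta>\<^sup>2)"
      using r_bounds sum_squares_bound[of z \<Delta>] by (intro mult_left_mono) auto
    finally show ?thesis unfolding z_def e_def by (simp add: algebra_simps)
  qed
  then have "expectation (\<lambda>\<omega>. (adapted_path f y0 (\<lambda>k. J k \<omega>) (Suc k) - \<Delta>)\<^sup>2) \<le>
      expectation (\<lambda>\<omega>. ?A * (?y \<omega> - \<Delta>)\<^sup>2 + ?C)"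
    unfolding expectation_path_Suc[of "\<lambda>y. (y - \<Delta>)\<^sup>2"]
    by (intro integral_mono integrable_path[of "\<lambda>y. r * (f k y 1 - \<Delta>)\<^sup>2 + (1 - r) * (f k y 0 - \<Delta>)\<^sup>2"]
        integrable_path[of "\<lambda>y. ?A * (y - \<Delta>)\<^sup>2 + ?C"])
  also have "\<dots> = ?A * expectation (\<lambda>\<omega>. (?y \<omega> - \<Delta>)\<^sup>2) + ?C"
    using integrable_path[of "\<lambda>y. (y - \<Delta>)\<^sup>2" f y0 k] prob_space by simp
  finally show ?thesis
    unfolding SA_est_eq_adapted_path f_def[abs_def] .
qed

lemma SA_est_L1_rate:
  assumes c: "0 < c" "c < 1" and eta_eq: "\<And>k. eta k = 1 / (real k + 1) powr c"
  shows "(\<lambda>k. expectation (\<lambda>\<omega>. \<bar>SA_est eta p y0 (\<lambda>i. I i \<omega>) k - \<Delta>\<bar>)) \<in> O(\<lambda>k. real k powr (- c / 2))"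
proof -
  let ?z = "\<lambda>k \<omega>. SA_est eta p y0 (\<lambda>i. I i \<omega>) k - \<Delta>"
  have r01: "0 < r" "r \<le> 1" using pos by (auto simp: r field_simps)
  obtain B N where B: "0 < B" "\<And>k. N \<le> k \<Longrightarrow> expectation (\<lambda>\<omega>. (?z k \<omega>)\<^sup>2) \<le> B * (1 / (real k + 1) powr c)"
    using powr_recursion_bound[OF c r01, of "\<lambda>k. expectation (\<lambda>\<omega>. (?z k \<omega>)\<^sup>2)"]
      SA_est_second_moment_rec unfolding eta_eq by blast
  have int: "integrable M (\<lambda>\<omega>. g (?z k \<omega>))" for g :: "real \<Rightarrow> real" and k
    unfolding SA_est_eq_adapted_path by (rule integrable_path[of "\<lambda>y. g (y - \<Delta>)"])
  \<comment> \<open>\<open>k = 0\<close> is left out because \<open>0 powr (- c / 2)\<close> is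
    \<open>0\<close>.\<close>
  have L1: "expectation (\<lambda>\<omega>. \<bar>?z k \<omega>\<bar>) \<le> sqrt B * real k powr (- c / 2)" if k: "max N 1 \<le> k" for k
  proof -
    \<comment> \<open>Nonnegativity of this variance bounds the squared first moment by the second
      moment.\<close>
    have "0 \<le> variance (\<lambda>\<omega>. \<bar>?z k \<omega>\<bar>)" by (rule variance_positive)
    also have "\<dots> = expectation (\<lambda>\<omega>. (?z k \<omega>)\<^sup>2) - (expectation (\<lambda>\<omega>. \<bar>?z k \<omega>\<bar>))\<^sup>2"
      using variance_eq[OF int[of "\<lambda>u. \<bar>u\<bar>" k] int[of "\<lambda>u. \<bar>u\<bar>\<^sup>2" k]] by simp
    finally have "(expectation (\<lambda>\<omega>. \<bar>?z k \<omega>\<bar>))\<^sup>2 \<le> B * (1 / (real k + 1) powr c)"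
      using B(2)[of k] k by simp
    also have "\<dots> \<le> B * (1 / real k powr c)"
      using B(1) c k by (intro mult_left_mono divide_left_mono powr_mono2) auto
    also have "\<dots> = (sqrt B * real k powr (- c / 2))\<^sup>2"
      using B(1) k by (simp add: power_mult_distrib powr_minus_divide powr_power power_divide)
    finally show ?thesis by (rule power2_le_imp_le) (use B(1) in simp)
  qed
  show ?thesis
  proof (rule bigoI)
    show "eventually (\<lambda>k. norm (expectation (\<lambda>\<omega>. \<bar>?z k \<omega>\<bar>)) \<le> sqrt B * norm (real k powr (- c / 2))) sequentially"
      using eventually_ge_at_top[of "max N 1"] by (rule eventually_mono) (use L1 in simp)
  qed
qed

end

end

text \<open>Since the steps are positive, \<open>\<not> summable eta\<close> says that their sum is
  infinite. Independence of \<open>case_sum S tau\<close> covers independence within each gap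
  sequence and between the two.\<close>

theorem theorem2:
  fixes M :: "'a measure"
    and S tau :: "nat \<Rightarrow> 'a \<Rightarrow> real"
    and \<Delta> p y0 :: real
    and eta :: "nat \<Rightarrow> real"
  assumes "prob_space M"
    and "\<Delta> > 0" and "p > 0"
    and "\<And>j. distributed M lborel (S j) (exponential_density \<Delta>)"
    and "\<And>k. distributed M lborel (tau k) (exponential_density p)"
    and "prob_space.indep_vars M (\<lambda>_. borel) (case_sum S tau) UNIV"
    and "\<And>k. eta k > 0"
  shows "((\<not> summable eta) \<and> summable (\<lambda>k. (eta k)\<^sup>2) \<longrightarrow>
            (AE \<omega> in M. (\<lambda>k. SA_est eta p y0 (\<lambda>i. changed_ind S tau i \<omega>) k) \<longlonglongrightarrow> \<Delta>))
       \<and> (\<forall>c. 0 < c \<and> c < 1 \<and> (\<forall>k. eta k = 1 / (real k + 1) powr c) \<longrightarrow>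
            (\<lambda>k. prob_space.expectation M
                   (\<lambda>\<omega>. \<bar>SA_est eta p y0 (\<lambda>i. changed_ind S tau i \<omega>) k - \<Delta>\<bar>))
            \<in> O(\<lambda>k. real k powr (- c / 2)))"
proof -
  interpret bernoulli_moments M "\<lambda>k \<omega>. 1 - changed_ind S tau (Suc k) \<omega>" "p / (\<Delta> + p)"
    by (rule bernoulli_moments_unchanged[OF assms(1-6)])
  have unchanged: "changed_ind S tau (Suc k) \<omega> = 1 - (1 - changed_ind S tau (Suc k) \<omega>)" for k \<omega>
    by simp
  show ?thesis
  proof (intro conjI allI impI)
    assume "\<not> summable eta \<and> summable (\<lambda>k. (eta k)\<^sup>2)"
    then show "AE \<omega> in M. (\<lambda>k. SA_est eta p y0 (\<lambda>i. changed_ind S tau i \<omega>) k) \<longlonglongrightarrow> \<Delta>"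
      using AE_SA_est_tendsto[where eta = eta, OF assms(2,3) refl unchanged assms(7)] by blast
  next
    fix c assume "0 < c \<and> c < 1 \<and> (\<forall>k. eta k = 1 / (real k + 1) powr c)"
    then show "(\<lambda>k. expectation (\<lambda>\<omega>. \<bar>SA_est eta p y0 (\<lambda>i. changed_ind S tau i \<omega>) k - \<Delta>\<bar>))
        \<in> O(\<lambda>k. real k powr (- c / 2))"
      using SA_est_L1_rate[where eta = eta, OF assms(2,3) refl unchanged assms(7)] by blast
  qed
qed

end
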